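(* Let $n,l\ge 0$, $\mathbf{A}\in\mathbb{R}^{m_{\mathbf{A}}\times(2^{n}-1)}$ and $\mathbf{B}\in\mathbb{R}^{m_{\mathbf{B}}\times(2^{n+l}-1)}$, and consider the existential information inequality $\mathbf{A}\stackrel{EII}{\to}\mathbf{B}$ (with $n$ variables and $l$ auxiliaries). The following are equivalent: 1. $\mathbf{A}\stackrel{EII}{\to}\mathbf{B}$ can be deduced using the elementary rules (Sha), (SubV), (SubA), (Cone), (Tran), (Abs). 2. $\mathbf{A}\stackrel{EII}{\to}\mathbf{B}$ is trivial, i.e., there exists $\mathbf{S}\in\{0,1\}^{l\times n}$ such that for all $\mathbf{k}\in\Gamma_n$, $\mathbf{A}\mathbf{k}\succeq 0$ implies $\mathbf{B}\,\mathrm{sub}([\mathbf{I}_n;\mathbf{S}])\,\mathbf{k}\succeq 0$. 3. There exist $\mathbf{S}\in\{0,1\}^{l\times n}$ and a matrix $\mathbf{D}$ with nonnegative entries such that $$\mathbf{B}\,\mathrm{sub}([\mathbf{I}_n;\mathbf{S}])=\mathbf{D}\begin{bmatrix}\mathbf{A}\\ \boldsymbol{\Gamma}_n\end{bmatrix},$$ where $\boldsymbol{\Gamma}_n$ is a matrix such that $\Gamma_n=\{\mathbf{k}\in\mathbb{R}^{2^n-1}:\boldsymbol{\Gamma}_n\mathbf{k}\succeq 0\}$.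
   Context: Indexing. Coordinates of $\mathbb{R}^{2^n-1}$ are indexed by nonempty subsets of $[n]=\{1,\dots,n\}$; the subset $\mathcal{S}$ has position $\sum_{k\in\mathcal{S}}2^{k-1}$. Matrices may have zero rows. $\succeq$ is the entrywise $\ge$. $[\mathbf{P};\mathbf{Q}]$ denotes vertical stacking, $\mathbf{I}_n$ the identity matrix, $\mathbf{0}^{a\times b}$ the zero $a\times b$ matrix. Entropic vectors. For jointly distributed discrete random variables $X^n=(X_1,\dots,X_n)$ (with finite entropies), $\mathbf{h}(X^n)\in\mathbb{R}^{2^n-1}$ has entries $\mathbf{h}_{\mathcal{S}}=H(X_{\mathcal{S}})$, the joint entropy of $\{X_i\}_{i\in\mathcal{S}}$. EII. For $\mathbf{A}$ of width $2^n-1$ and $\mathbf{B}$ of width $2^{n+l}-1$, the formal expression $\mathbf{A}\stackrel{EII}{\to}\mathbf{B}$ stands for the statement: for all $X^n$ with $\mathbf{A}\mathbf{h}(X^n)\succeq 0$ there exist $U^l$ (given by a conditional distribution $p_{U^l|X^n}$) with $\mathbf{B}\mathbf{h}(X^n,U^l)\succeq 0$, where $(X^n,U^l)$ is the sequence $X_1,\dots,X_n,U_1,\dots,U_l$. In items 1–3 it is treated as a formal object, i.e. the tuple $(n,l,\mathbf{A},\mathbf{B})$. Shannon cone. $\Gamma_n$ is the set of $\mathbf{k}\in\mathbb{R}^{2^n-1}$ such that, with $\mathbf{k}_\emptyset:=0$, $\mathbf{k}_{\mathcal{S}}\le\mathbf{k}_{\mathcal{T}}$ for all $\mathcal{S}\subseteq\mathcal{T}\subseteq[n]$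 and $\mathbf{k}_{\mathcal{S}}+\mathbf{k}_{\mathcal{T}}\ge\mathbf{k}_{\mathcal{S}\cup\mathcal{T}}+\mathbf{k}_{\mathcal{S}\cap\mathcal{T}}$ for all $\mathcal{S},\mathcal{T}\subseteq[n]$. It is a polyhedral cone; $\boldsymbol{\Gamma}_n$ is a fixed matrix describing it (e.g. its rows are the elemental Shannon-type inequalities). Entropic substitution matrix. For $\mathbf{S}\in\mathbb{R}_{\ge0}^{l\times n}$, $\mathrm{sub}(\mathbf{S})\in\{0,1\}^{(2^l-1)\times(2^n-1)}$ has, for nonempty $\mathcal{T}\subseteq[l]$, $\mathcal{U}\subseteq[n]$, entry $(\mathcal{T},\mathcal{U})$ equal to $1$ if $\mathcal{U}=\{j\in[n]:\sum_{i\in\mathcal{T}}\mathbf{S}_{i,j}\ne0\}$ and $0$ otherwise. Elementary rules. "Can be deduced using the elementary rules" means membership in the smallest set of formal EIIs closed under the following rules, for all $n,l,k\ge0$ and all matrices $\mathbf{A}$ of width $2^n-1$, $\mathbf{B}$ of width $2^{n+l}-1$, $\mathbf{C}$ of width $2^{n+l+k}-1$: - (Sha) $\mathbf{0}^{0\times7}\stackrel{EII}{\to}[0,0,0,-1,1,1,-1]$ (three variables, no auxiliaries; it states $I(X;Y|Z)\ge0$). - (SubV) For $n'\ge1$ and $\mathbf{S}\in\{0,1\}^{n\times n'}$: from $\mathbf{A}\stackrel{EII}{\to}\mathbf{B}$ deduce $\mathbf{A}\,\mathrm{sub}(\mathbf{S})\stackrel{EII}{\to}\mathbf{B}\,\mathrm{sub}\left(\begin{bmatrix}\mathbf{S}&\mathbf{0}^{n\times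 l}\\ \mathbf{0}^{l\times n'}&\mathbf{I}_l\end{bmatrix}\right)$ ($n'$ variables, $l$ auxiliaries). - (SubA) For $l'\ge0$ and $\mathbf{S}\in\{0,1\}^{l\times(n+l')}$: from $\mathbf{A}\stackrel{EII}{\to}\mathbf{B}\,\mathrm{sub}\left(\begin{bmatrix}[\mathbf{I}_n\,|\,\mathbf{0}^{n\times l'}]\\ \mathbf{S}\end{bmatrix}\right)$ ($n$ variables, $l'$ auxiliaries) deduce $\mathbf{A}\stackrel{EII}{\to}\mathbf{B}$ ($n$ variables, $l$ auxiliaries). - (Cone) $\mathbf{A}\stackrel{EII}{\to}\mathbf{D}\mathbf{A}$ for every matrix $\mathbf{D}$ with nonnegative entries and $m_{\mathbf{A}}$ columns (no auxiliaries). - (Tran) From $\mathbf{A}\stackrel{EII}{\to}\mathbf{B}$ ($n$ variables, $l$ auxiliaries) and $\mathbf{B}\stackrel{EII}{\to}\mathbf{C}$ ($n+l$ variables, $k$ auxiliaries) deduce $\mathbf{A}\stackrel{EII}{\to}\mathbf{C}$ ($n$ variables, $l+k$ auxiliaries). - (Abs) From $\mathbf{A}\stackrel{EII}{\to}\mathbf{B}$ deduce $\mathbf{A}\stackrel{EII}{\to}\begin{bmatrix}\mathbf{B}\\ [\mathbf{A}\,|\,\mathbf{0}]\end{bmatrix}$, where $\mathbf{A}$ is padded with zero columns on the right to the width of $\mathbf{B}$. *)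

theory Defs
  imports "Jordan_Normal_Form.Matrix" "HOL-Library.Nat_Bijection"
begin

text \<open>
  The variables are numbered \<open>0, \<dots>, n - 1\<close>, as are rows and columns of matrices. A nonempty set of
  variables \<open>S \<subseteq> {..<n}\<close> has coordinate \<open>set_encode S - 1 = (\<Sum>k\<in>S. 2 ^ k) - 1\<close> in a vector
  of dimension \<open>2 ^ n - 1\<close>; conversely coordinate \<open>i\<close> belongs to the set \<open>set_decode (Suc i)\<close>.
\<close>

definition coord :: "real vec \<Rightarrow> nat set \<Rightarrow> real" where
  "coord k S = (if S = {} then 0 else k $ (set_encode S - 1))"

definition shannon_cone :: "nat \<Rightarrow> real vec set" where
  "shannon_cone n = {k \<in> carrier_vec (2 ^ n - 1).
     (\<forall>S T. S \<subseteq> T \<and> T \<subseteq> {..<n} \<longrightarrow> coord k S \<le> coord k T) \<and>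
     (\<forall>S T. S \<subseteq> {..<n} \<and> T \<subseteq> {..<n} \<longrightarrow>
        coord k S + coord k T \<ge> coord k (S \<union> T) + coord k (S \<inter> T))}"

definition sub :: "real mat \<Rightarrow> real mat" where
  "sub S = mat (2 ^ dim_row S - 1) (2 ^ dim_col S - 1)
     (\<lambda>(t, u). if set_decode (Suc u) =
                    {j. j < dim_col S \<and> (\<Sum>i\<in>set_decode (Suc t). S $$ (i, j)) \<noteq> 0}
               then 1 else 0)"

definition binary_mats :: "nat \<Rightarrow> nat \<Rightarrow> real mat set" where
  "binary_mats r c = {S \<in> carrier_mat r c. elements_mat S \<subseteq> {0, 1}}"

definition append_cols :: "real mat \<Rightarrow> real mat \<Rightarrow> real mat" (infixr \<open>@\<^sub>c\<close> 66) where
  "A @\<^sub>c B = four_block_mat A B (0\<^sub>m 0 (dim_col A)) (0\<^sub>m 0 (dim_col B))"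

text \<open>
  A formal EII with \<open>n\<close> variables and \<open>l\<close> auxiliaries is the tuple \<open>(n, l, A, B)\<close>, where \<open>A\<close> has
  width \<open>2 ^ n - 1\<close> and \<open>B\<close> has width \<open>2 ^ (n + l) - 1\<close>. Matrices carry their dimensions, so
  matrices without rows but of different widths are distinct.
\<close>

inductive deducible :: "nat \<Rightarrow> nat \<Rightarrow> real mat \<Rightarrow> real mat \<Rightarrow> bool" where
  Sha: "deducible 3 0 (0\<^sub>m 0 7) (mat_of_rows_list 7 [[0, 0, 0, -1, 1, 1, -1]])"
| SubV: "deducible n' l (A * sub S)
           (B * sub (four_block_mat S (0\<^sub>m n l) (0\<^sub>m l n') (1\<^sub>m l)))"
  if "deducible n l A B"
    and "A \<in> carrier_mat mA (2 ^ n - 1)" "B \<in> carrier_mat mB (2 ^ (n + l) - 1)"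
    and "n' \<ge> 1" "S \<in> binary_mats n n'"
| SubA: "deducible n l A B"
  if "deducible n l' A (B * sub ((1\<^sub>m n @\<^sub>c 0\<^sub>m n l') @\<^sub>r S))"
    and "A \<in> carrier_mat mA (2 ^ n - 1)" "B \<in> carrier_mat mB (2 ^ (n + l) - 1)"
    and "S \<in> binary_mats l (n + l')"
| Cone: "deducible n 0 A (D * A)"
  if "A \<in> carrier_mat mA (2 ^ n - 1)" "D \<in> carrier_mat r mA" "0\<^sub>m r mA \<le> D"
| Tran: "deducible n (l + k) A C"
  if "deducible n l A B" "deducible (n + l) k B C"
    and "A \<in> carrier_mat mA (2 ^ n - 1)" "B \<in> carrier_mat mB (2 ^ (n + l) - 1)"
    and "C \<in> carrier_mat mC (2 ^ (n + l + k) - 1)"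
| Abs: "deducible n l A (B @\<^sub>r (A @\<^sub>c 0\<^sub>m mA (2 ^ (n + l) - 2 ^ n)))"
  if "deducible n l A B"
    and "A \<in> carrier_mat mA (2 ^ n - 1)" "B \<in> carrier_mat mB (2 ^ (n + l) - 1)"

definition trivial_eii :: "nat \<Rightarrow> nat \<Rightarrow> real mat \<Rightarrow> real mat \<Rightarrow> bool" where
  "trivial_eii n l A B \<longleftrightarrow>
     (\<exists>S \<in> binary_mats l n. \<forall>k \<in> shannon_cone n.
        0\<^sub>v (dim_row A) \<le> A *\<^sub>v k \<longrightarrow>
        0\<^sub>v (dim_row B) \<le> (B * sub (1\<^sub>m n @\<^sub>r S)) *\<^sub>v k)"

definition describes_shannon_cone :: "nat \<Rightarrow> real mat \<Rightarrow> bool" where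
  "describes_shannon_cone n G \<longleftrightarrow>
     dim_col G = 2 ^ n - 1 \<and>
     shannon_cone n = {k \<in> carrier_vec (2 ^ n - 1). 0\<^sub>v (dim_row G) \<le> G *\<^sub>v k}"

lemma set_encode_bound:
  assumes "S \<subseteq> {..<n}" "S \<noteq> {}"
  shows "set_encode S - 1 < 2 ^ n - 1"
proof -
  have fin: "finite S" using assms(1) finite_subset by blast
  have "set_encode S \<le> set_encode {..<n}"
    unfolding set_encode_def by (rule sum_mono2) (use assms in auto)
  also have "set_encode {..<n} = 2 ^ n - 1"
    unfolding set_encode_def by (simp add: atLeast0LessThan[symmetric] sum_power2)
  finally have "set_encode S \<le> 2 ^ n - 1" .
  moreover have "set_encode S \<noteq> 0" using assms(2) fin by (metis set_encode_empty set_encode_eq finite.emptyI)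
  ultimately show ?thesis by linarith
qed

lemma ex_describes_shannon_cone: "\<exists>G. describes_shannon_cone n G"
proof -
  define N :: nat where "N = 2 ^ n - 1"
  define e :: "nat set \<Rightarrow> real vec" where
    "e S = (if S = {} then 0\<^sub>v N else unit_vec N (set_encode S - 1))" for S
  have e: "e S \<in> carrier_vec N" for S by (simp add: e_def)
  have ek: "e S \<bullet> k = coord k S" if "S \<subseteq> {..<n}" "k \<in> carrier_vec N" for S k
    using that set_encode_bound[of S n] by (auto simp: e_def coord_def N_def)
  define mono where "mono = (\<lambda>(S, T). e T - e S)"
  define subm where "subm = (\<lambda>(S, T). (e S + e T) - (e (S \<union> T) + e (S \<inter> T)))"
  define P where "P = {(S, T). S \<subseteq> T \<and> T \<subseteq> {..<n}}"
  define Q where "Q = {(S, T). S \<subseteq> {..<n} \<and> T \<subseteq> {..<n}}"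
  have "Q = Pow {..<n} \<times> Pow {..<n}" by (auto simp: Q_def)
  then have finQ: "finite Q" by simp
  have "P \<subseteq> Q" by (auto simp: P_def Q_def)
  with finQ have "finite P" using finite_subset by blast
  with finQ obtain rs where rs: "set rs = mono ` P \<union> subm ` Q"
    by (metis finite_UnI finite_imageI finite_list)
  have rsN: "set rs \<subseteq> carrier_vec N"
    unfolding rs by (auto simp: mono_def subm_def intro!: minus_carrier_vec add_carrier_vec e)
  define G where "G = mat_of_rows N rs"
  have G: "G \<in> carrier_mat (length rs) N" by (simp add: G_def)
  have iff: "0\<^sub>v (dim_row G) \<le> G *\<^sub>v k \<longleftrightarrow> k \<in> shannon_cone n" if k: "k \<in> carrier_vec N" for k
  proof -
    have "0\<^sub>v (dim_row G) \<le> G *\<^sub>v k \<longleftrightarrow> (\<forall>i < length rs. 0 \<le> rs ! i \<bullet> k)"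
      using rsN G by (auto simp: less_eq_vec_def G_def subset_iff)
    also have "\<dots> \<longleftrightarrow> (\<forall>r \<in> set rs. 0 \<le> r \<bullet> k)"
      by (metis in_set_conv_nth)
    also have "\<dots> \<longleftrightarrow> (\<forall>p \<in> P. 0 \<le> mono p \<bullet> k) \<and> (\<forall>p \<in> Q. 0 \<le> subm p \<bullet> k)"
      unfolding rs by auto
    also have "(\<forall>p \<in> P. 0 \<le> mono p \<bullet> k) \<longleftrightarrow>
        (\<forall>S T. S \<subseteq> T \<and> T \<subseteq> {..<n} \<longrightarrow> coord k S \<le> coord k T)"
    proof -
      have "mono (S, T) \<bullet> k = coord k T - coord k S" if "S \<subseteq> T" "T \<subseteq> {..<n}" for S T
      proof -
        have "S \<subseteq> {..<n}" using that by auto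
        then show ?thesis
          unfolding mono_def using that e ek k by (simp add: minus_scalar_prod_distrib[OF e e k])
      qed
      then show ?thesis unfolding P_def by fastforce
    qed
    also have "(\<forall>p \<in> Q. 0 \<le> subm p \<bullet> k) \<longleftrightarrow>
        (\<forall>S T. S \<subseteq> {..<n} \<and> T \<subseteq> {..<n} \<longrightarrow>
          coord k S + coord k T \<ge> coord k (S \<union> T) + coord k (S \<inter> T))"
    proof -
      have "subm (S, T) \<bullet> k = coord k S + coord k T - (coord k (S \<union> T) + coord k (S \<inter> T))"
        if "S \<subseteq> {..<n}" "T \<subseteq> {..<n}" for S T
      proof -
        have "S \<union> T \<subseteq> {..<n}" "S \<inter> T \<subseteq> {..<n}" using that by auto
        then show ?thesis
          unfolding subm_def using that ek k
          by (simp add: minus_scalar_prod_distrib[OF add_carrier_vec[OF e e] add_carrier_vec[OF e e] k]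
              add_scalar_prod_distrib[OF e e k])
      qed
      then show ?thesis unfolding Q_def by fastforce
    qed
    finally show ?thesis using k by (simp add: shannon_cone_def N_def)
  qed
  have "shannon_cone n \<subseteq> carrier_vec N" by (auto simp: shannon_cone_def N_def)
  with iff have "shannon_cone n = {k \<in> carrier_vec N. 0\<^sub>v (dim_row G) \<le> G *\<^sub>v k}" by blast
  with G show ?thesis unfolding describes_shannon_cone_def N_def[symmetric] by auto
qed

end

theory Submission
  imports Defs
begin

text \<open>
  Farkas' lemma identifies (2) with (3). For (2) \<open>\<Longrightarrow>\<close> (1), submodularity and monotonicity of all
  coordinates are together equivalent to
  \<open>h (P \<union> R) + h (Q \<union> R) \<ge> h R + h (P \<union> Q \<union> R)\<close> for all \<open>P, Q, R\<close>, and each such inequality is an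
  instance of (Sha) under (SubV). They can therefore be added to \<open>A\<close> one at a time by (Cone), (Tran)
  and (Abs); Farkas' lemma and (Cone) then produce \<open>B * sub (1\<^sub>m n @\<^sub>r S)\<close>, and (SubA) removes the
  substitution. For (1) \<open>\<Longrightarrow>\<close> (2), \<open>sub M\<close> is the pullback of set functions along the
  union-preserving map \<open>T \<mapsto> (\<Union>i\<in>T. row_support M i)\<close>. Hence it maps Shannon cones to Shannon cones
  and is compatible with composition, so that every rule preserves triviality.
\<close>

declare One_nat_def [simp del]

section \<open>Farkas' lemma\<close>

text \<open>Bartl's algebraic proof, by induction on the number of functionals.\<close>

lemma farkas_fun:
  fixes a :: "nat \<Rightarrow> nat \<Rightarrow> real"
  assumes "\<And>x. (\<And>i. i < m \<Longrightarrow> 0 \<le> (\<Sum>j<N. a i j * x j)) \<Longrightarrow> 0 \<le> (\<Sum>j<N. b j * x j)"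
  shows "\<exists>c. (\<forall>i<m. 0 \<le> c i) \<and> (\<forall>j<N. b j = (\<Sum>i<m. c i * a i j))"
  using assms
proof (induction m arbitrary: a b)
  case 0
  have "b j = 0" if "j < N" for j
  proof -
    have "(\<Sum>i<N. b i * (if i = j then t else 0)) = b j * t" for t
      using that by (simp add: if_distrib cong: if_cong)
    \<comment> \<open>Without functionals every vector is admissible. The vector with the single
      entry \<open>- b j\<close> at \<open>j\<close> gives the value \<open>- (b j * b j)\<close>,
      which forces \<open>b j = 0\<close>.\<close>
    with 0[of "\<lambda>i. if i = j then - b j else 0"] have "0 \<le> b j * - b j" by simp
    then show ?thesis by (auto simp: mult_le_0_iff)
  qed
  then show ?case by simp
next
  case (Suc m)
  define ev where "ev f x = (\<Sum>j<N. f j * x j)" for f x :: "nat \<Rightarrow> real"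
  have ev_add: "ev (\<lambda>j. f j + t * g j) x = ev f x + t * ev g x" for f g x t
    by (simp add: ev_def sum.distrib sum_distrib_left algebra_simps)
  have ev_add': "ev f (\<lambda>j. x j + t * y j) = ev f x + t * ev f y" for f x y t
    by (simp add: ev_def sum.distrib sum_distrib_left algebra_simps)
  have imp: "0 \<le> ev b x" if "\<And>i. i < Suc m \<Longrightarrow> 0 \<le> ev (a i) x" for x
    using Suc.prems that unfolding ev_def by blast
  show ?case
  proof (cases "\<forall>x. (\<forall>i<m. 0 \<le> ev (a i) x) \<longrightarrow> 0 \<le> ev b x")
    case True
    then obtain c where c: "\<forall>i<m. 0 \<le> c i" "\<forall>j<N. b j = (\<Sum>i<m. c i * a i j)"
      using Suc.IH[of a b] unfolding ev_def by blast
    then show ?thesis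
      by (intro exI[of _ "c(m := 0)"]) (simp add: less_Suc_eq)
  next
    case False
    then obtain y where y: "\<And>i. i < m \<Longrightarrow> 0 \<le> ev (a i) y" "ev b y < 0" by force
    \<comment> \<open>\<open>y\<close> meets the first \<open>m\<close> constraints but violates the
      conclusion, so it has to violate the last constraint.\<close>
    with imp[of y] have neg: "ev (a m) y < 0" by (metis less_Suc_eq not_le)
    define s where "s = - 1 / ev (a m) y"
    have s: "s > 0" "s * ev (a m) y = - 1" using neg by (auto simp: s_def field_simps)
    \<comment> \<open>Eliminate the last functional by projecting along \<open>y\<close> onto its kernel.\<close>
    define a' where "a' i = (\<lambda>j. a i j + s * ev (a i) y * a m j)" for i
    define b' where "b' = (\<lambda>j. b j + s * ev b y * a m j)"
    have "0 \<le> ev b' x" if x: "\<And>i. i < m \<Longrightarrow> 0 \<le> ev (a' i) x" for x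
    proof -
      \<comment> \<open>The scaling \<open>s\<close> puts \<open>z\<close> into the kernel of
        \<open>a m\<close>. The primed functionals at \<open>x\<close> are the original ones at
        \<open>z\<close>.\<close>
      define z where "z = (\<lambda>j. x j + s * ev (a m) x * y j)"
      have z: "ev (\<lambda>j. f j + s * ev f y * a m j) x = ev f z" for f
        by (simp add: z_def ev_add ev_add')
      have "ev (a m) z = ev (a m) x * (1 + s * ev (a m) y)"
        unfolding z_def ev_add' by (simp add: algebra_simps)
      then have "ev (a m) z = 0" using s by simp
      moreover have "0 \<le> ev (a i) z" if "i < m" for i
        using x[OF that] z[of "a i"] by (simp add: a'_def)
      ultimately have "0 \<le> ev b z" by (intro imp) (auto simp: less_Suc_eq)
      then show ?thesis using z[of b] by (simp add: b'_def)
    qed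
    then obtain c where c: "\<forall>i<m. 0 \<le> c i" "\<forall>j<N. b' j = (\<Sum>i<m. c i * a' i j)"
      using Suc.IH[of a' b'] unfolding ev_def by blast
    \<comment> \<open>This is the coefficient that \<open>a m\<close> collects when
      \<open>b'\<close> and all \<open>a' i\<close> are expanded.\<close>
    define d where "d = s * ((\<Sum>i<m. c i * ev (a i) y) - ev b y)"
    have "0 \<le> (\<Sum>i<m. c i * ev (a i) y)" using c(1) y(1) by (intro sum_nonneg mult_nonneg_nonneg) auto
    then have "0 \<le> d" using s(1) y(2) by (simp add: d_def)
    moreover have "b j = (\<Sum>i<m. c i * a i j) + d * a m j" if "j < N" for j
    proof -
      have "b j = b' j - s * ev b y * a m j" by (simp add: b'_def)
      also have "b' j = (\<Sum>i<m. c i * a' i j)" using c(2) that by blast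
      also have "\<dots> = (\<Sum>i<m. c i * a i j) + s * (\<Sum>i<m. c i * ev (a i) y) * a m j"
        by (simp add: a'_def sum.distrib sum_distrib_left sum_distrib_right algebra_simps)
      finally show ?thesis by (simp add: d_def algebra_simps)
    qed
    ultimately show ?thesis using c(1)
      by (intro exI[of _ "c(m := d)"]) (simp add: less_Suc_eq)
  qed
qed

text \<open>Each row of \<open>C\<close> is a functional that is nonnegative on the cone cut out by
  \<open>M\<close>, and its multipliers form the corresponding row of \<open>D\<close>.\<close>

lemma farkas_mat:
  fixes M C :: "real mat"
  assumes M: "M \<in> carrier_mat m N" and C: "C \<in> carrier_mat r N"
    and imp: "\<And>k. k \<in> carrier_vec N \<Longrightarrow> 0\<^sub>v m \<le> M *\<^sub>v k \<Longrightarrow> 0\<^sub>v r \<le> C *\<^sub>v k"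
  shows "\<exists>D \<in> carrier_mat r m. 0\<^sub>m r m \<le> D \<and> C = D * M"
proof -
  have "\<exists>c. (\<forall>i<m. 0 \<le> c i) \<and> (\<forall>j<N. C $$ (p, j) = (\<Sum>i<m. c i * M $$ (i, j)))" if p: "p < r" for p
  proof (rule farkas_fun)
    fix x :: "nat \<Rightarrow> real"
    assume x: "\<And>i. i < m \<Longrightarrow> 0 \<le> (\<Sum>j<N. M $$ (i, j) * x j)"
    have "row E i \<bullet> vec N x = (\<Sum>j<N. E $$ (i, j) * x j)"
      if "E \<in> carrier_mat q N" "i < q" for E :: "real mat" and i q
      using that by (simp add: scalar_prod_def atLeast0LessThan)
    then show "0 \<le> (\<Sum>j<N. C $$ (p, j) * x j)"
      using imp[of "vec N x"] x M C p by (auto simp: less_eq_vec_def)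
  qed
  then obtain c where c: "\<And>p i. p < r \<Longrightarrow> i < m \<Longrightarrow> 0 \<le> c p i"
    "\<And>p j. p < r \<Longrightarrow> j < N \<Longrightarrow> C $$ (p, j) = (\<Sum>i<m. c p i * M $$ (i, j))"
    by metis
  show ?thesis
  proof (intro bexI conjI)
    show "C = mat r m (\<lambda>(p, i). c p i) * M"
      using M C c(2) by (intro eq_matI) (auto simp: scalar_prod_def atLeast0LessThan)
  qed (auto simp: less_eq_mat_def c(1))
qed
section \<open>Block matrices\<close>

lemma append_rows_nonneg_iff:
  fixes P Q :: "real mat"
  assumes "P \<in> carrier_mat p N" "Q \<in> carrier_mat q N" "k \<in> carrier_vec N"
  shows "0\<^sub>v (p + q) \<le> (P @\<^sub>r Q) *\<^sub>v k \<longleftrightarrow> 0\<^sub>v p \<le> P *\<^sub>v k \<and> 0\<^sub>v q \<le> Q *\<^sub>v k"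
proof -
  have "0\<^sub>v (p + q) = 0\<^sub>v p @\<^sub>v (0\<^sub>v q :: real vec)" by (intro eq_vecI) auto
  then show ?thesis
    using assms unfolding mat_mult_append[OF assms]
    by (simp only:) (subst append_vec_le[where n = p], auto)
qed

lemma nonneg_mat_mult_nonneg_vec:
  fixes D :: "real mat"
  assumes "D \<in> carrier_mat r m" "0\<^sub>m r m \<le> D" "0\<^sub>v m \<le> v"
  shows "0\<^sub>v r \<le> D *\<^sub>v v"
  using assms by (auto simp: less_eq_vec_def less_eq_mat_def scalar_prod_def intro!: sum_nonneg)

text \<open>Serves (Abs), with \<open>p = 2 ^ n - 1\<close>: the padding ignores all coordinates of
  sets that contain an auxiliary.\<close>

lemma append_cols_zero_mult_vec:
  fixes A :: "real mat"
  assumes "A \<in> carrier_mat m p" "v \<in> carrier_vec (p + q)"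
  shows "(A @\<^sub>c 0\<^sub>m m q) *\<^sub>v v = A *\<^sub>v vec_first v p"
proof (intro eq_vecI)
  fix i assume "i < dim_vec (A *\<^sub>v vec_first v p)"
  then have i: "i < m" using assms by simp
  have "((A @\<^sub>c 0\<^sub>m m q) *\<^sub>v v) $ i = (\<Sum>j<p + q. (if j < p then A $$ (i, j) else 0) * v $ j)"
    using assms i by (auto simp: append_cols_def scalar_prod_def atLeast0LessThan intro!: sum.cong)
  also have "\<dots> = (\<Sum>j<p. (if j < p then A $$ (i, j) else 0) * v $ j)"
    by (rule sum.mono_neutral_right) auto
  also have "\<dots> = (A *\<^sub>v vec_first v p) $ i"
    using assms i by (auto simp: scalar_prod_def atLeast0LessThan vec_first_def)
  finally show "((A @\<^sub>c 0\<^sub>m m q) *\<^sub>v v) $ i = (A *\<^sub>v vec_first v p) $ i" .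
qed (use assms in \<open>auto simp: append_cols_def\<close>)

lemma append_cols_zero_width [simp]: "A @\<^sub>c 0\<^sub>m m 0 = A" if "A \<in> carrier_mat m p" for A :: "real mat"
  using that by (intro eq_matI) (auto simp: append_cols_def)

text \<open>Without auxiliaries the stacked substitution collapses to the identity, as happens for
  (Sha) and (Cone).\<close>

lemma append_rows_no_rows [simp]: "A @\<^sub>r S = A" if "A \<in> carrier_mat m p" "S \<in> carrier_mat 0 p"
  using that by (intro eq_matI) (auto simp: append_rows_def)

section \<open>Coordinates indexed by sets\<close>

lemma set_decode_subset:
  assumes "x < 2 ^ n"
  shows "set_decode x \<subseteq> {..<n}"
proof
  fix i assume i: "i \<in> set_decode x"
  have "x div 2 ^ i = 0" if "n \<le> i"
    using assms power_increasing[OF that, of "2::nat"] by (intro div_less) linarith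
  with i show "i \<in> {..<n}" by (fastforce simp: set_decode_def not_less)
qed

text \<open>The empty set has code 0 and owns no coordinate, hence the shift by one. It can be
  undone because nonempty sets have positive codes.\<close>

lemma set_decode_Suc_encode:
  assumes "S \<subseteq> {..<n}" "S \<noteq> {}"
  shows "set_decode (Suc (set_encode S - 1)) = S"
proof -
  have "finite S" using assms finite_subset by blast
  moreover from this have "set_encode S \<noteq> 0"
    using assms by (metis set_encode_inverse set_decode_zero)
  ultimately show ?thesis by simp
qed

lemma set_decode_Suc_nonempty: "set_decode (Suc u) \<noteq> {}"
  by (metis set_decode_inverse set_encode_empty nat.distinct(1))

text \<open>Lets vector identities be proved as identities of set functions, away from index
  arithmetic.\<close>

lemma coord_ext:
  assumes "v \<in> carrier_vec (2 ^ n - 1)" "w \<in> carrier_vec (2 ^ n - 1)"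
    and "\<And>T. T \<subseteq> {..<n} \<Longrightarrow> coord v T = coord w T"
  shows "v = w"
proof (intro eq_vecI)
  fix i assume "i < dim_vec w"
  then have "Suc i < 2 ^ n" using assms(2) by simp
  from assms(3)[OF set_decode_subset[OF this]] show "v $ i = w $ i"
    by (simp add: coord_def set_decode_Suc_nonempty)
qed (use assms in auto)

text \<open>In the binary numbering the nonempty subsets of \<open>{..<n}\<close> occupy exactly the
  first \<open>2 ^ n - 1\<close> positions, so truncation restricts the set function.\<close>

lemma coord_vec_first:
  assumes "T \<subseteq> {..<n}"
  shows "coord (vec_first v (2 ^ n - 1)) T = coord v T"
  using set_encode_bound[OF assms] by (auto simp: coord_def vec_first_def)

section \<open>Entropic substitution\<close>

lemma binary_mats_iff:
  "S \<in> binary_mats r c \<longleftrightarrow> S \<in> carrier_mat r c \<and> (\<forall>i<r. \<forall>j<c. S $$ (i, j) \<in> {0, 1})"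
  unfolding binary_mats_def by (fastforce simp: elements_mat_def)

lemma binary_mats_carrier: "S \<in> binary_mats r c \<Longrightarrow> S \<in> carrier_mat r c"
  by (simp add: binary_mats_def)

lemma binary_mats_one [intro]: "1\<^sub>m n \<in> binary_mats n n"
  by (auto simp: binary_mats_iff)

lemma binary_mats_zero [intro]: "0\<^sub>m r c \<in> binary_mats r c"
  by (auto simp: binary_mats_iff)

lemma binary_mats_four_block [intro]:
  assumes "P \<in> binary_mats r c" "Q \<in> binary_mats r c'" "P' \<in> binary_mats r' c" "Q' \<in> binary_mats r' c'"
  shows "four_block_mat P Q P' Q' \<in> binary_mats (r + r') (c + c')"
  using assms elements_four_block_mat[of P r c Q c' P' r' Q'] unfolding binary_mats_def by auto

lemma binary_mats_append_rows [intro]: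
  assumes "P \<in> binary_mats p c" "Q \<in> binary_mats q c"
  shows "P @\<^sub>r Q \<in> binary_mats (p + q) c"
  using binary_mats_four_block[of P p c "0\<^sub>m p 0" 0 Q q "0\<^sub>m q 0"] assms
    binary_mats_carrier[OF assms(1)] binary_mats_carrier[OF assms(2)]
  by (auto simp: append_rows_def)

lemma binary_mats_append_cols [intro]:
  assumes "P \<in> binary_mats r p" "Q \<in> binary_mats r q"
  shows "P @\<^sub>c Q \<in> binary_mats r (p + q)"
  using binary_mats_four_block[of P r p Q q "0\<^sub>m 0 p" 0 "0\<^sub>m 0 q"] assms
    binary_mats_carrier[OF assms(1)] binary_mats_carrier[OF assms(2)]
  by (auto simp: append_cols_def)

text \<open>Realises prescribed row supports. The composite substitutions needed for soundness are
  built this way.\<close>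

definition indicator_mat :: "nat \<Rightarrow> nat \<Rightarrow> (nat \<Rightarrow> nat set) \<Rightarrow> real mat" where
  "indicator_mat r c f = mat r c (\<lambda>(i, j). if j \<in> f i then 1 else 0)"

lemma indicator_mat_binary [intro]: "indicator_mat r c f \<in> binary_mats r c"
  by (auto simp: binary_mats_iff indicator_mat_def)

text \<open>A 0/1 matrix is determined by the positions of its ones. Finiteness matters because
  instances of (Sha) are stacked one at a time.\<close>

lemma finite_binary_mats: "finite (binary_mats r c)"
proof (rule finite_subset)
  show "binary_mats r c \<subseteq> (\<lambda>X. indicator_mat r c (\<lambda>i. X `` {i})) ` Pow ({..<r} \<times> {..<c})"
  proof
    fix S assume S: "S \<in> binary_mats r c"
    let ?X = "{(i, j). i < r \<and> j < c \<and> S $$ (i, j) = 1}"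
    have "S = indicator_mat r c (\<lambda>i. ?X `` {i})"
      using S by (intro eq_matI) (auto simp: binary_mats_iff indicator_mat_def)
    then show "S \<in> (\<lambda>X. indicator_mat r c (\<lambda>i. X `` {i})) ` Pow ({..<r} \<times> {..<c})" by blast
  qed
qed auto

text \<open>Under the substitution \<open>M\<close>, variable \<open>i\<close> becomes the joint
  variable formed by this set. For nonnegative entries \<open>sub M\<close> depends on these sets
  only.\<close>

definition row_support :: "real mat \<Rightarrow> nat \<Rightarrow> nat set" where
  "row_support M i = {j. j < dim_col M \<and> M $$ (i, j) \<noteq> 0}"

lemma row_support_subset: "M \<in> carrier_mat r c \<Longrightarrow> row_support M i \<subseteq> {..<c}"
  by (auto simp: row_support_def)

lemma row_support_one [simp]: "i < n \<Longrightarrow> row_support (1\<^sub>m n) i = {i}"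
  by (auto simp: row_support_def split: if_splits)

lemma row_support_indicator_mat:
  "i < r \<Longrightarrow> f i \<subseteq> {..<c} \<Longrightarrow> row_support (indicator_mat r c f) i = f i"
  by (auto simp: row_support_def indicator_mat_def split: if_splits)

lemma row_support_append_rows:
  assumes "P \<in> carrier_mat p c" "Q \<in> carrier_mat q c" "i < p + q"
  shows "row_support (P @\<^sub>r Q) i = (if i < p then row_support P i else row_support Q (i - p))"
  using assms by (auto simp: row_support_def append_rows_def)

lemma row_support_append_cols_zero:
  assumes "P \<in> carrier_mat r c" "i < r"
  shows "row_support (P @\<^sub>c 0\<^sub>m r q) i = row_support P i"
  using assms by (auto simp: row_support_def append_cols_def split: if_splits)

lemma row_support_block_diag:
  assumes "S \<in> carrier_mat n c" "i < n + l"
  shows "row_support (four_block_mat S (0\<^sub>m n l) (0\<^sub>m l c) (1\<^sub>m l)) i =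
    (if i < n then row_support S i else {c + (i - n)})"
  using assms by (auto simp: row_support_def split: if_splits)

section \<open>Substitution as pullback of set functions\<close>

lemma sub_carrier:
  "S \<in> carrier_mat r c \<Longrightarrow> sub S \<in> carrier_mat (2 ^ r - 1) (2 ^ c - 1)"
  by (auto simp: sub_def)

lemma sub_mult_carrier:
  "S \<in> binary_mats r c \<Longrightarrow> k \<in> carrier_vec (2 ^ c - 1) \<Longrightarrow> sub S *\<^sub>v k \<in> carrier_vec (2 ^ r - 1)"
  using sub_carrier[OF binary_mats_carrier] by (meson mult_mat_vec_carrier)

text \<open>Row \<open>T\<close> of \<open>sub M\<close> has at most one nonzero entry, at the union
  of the supports. All later facts about \<open>sub\<close> go through this formula instead of the
  matrix.\<close>

lemma coord_sub_mult:
  assumes M: "M \<in> binary_mats r c" and k: "k \<in> carrier_vec (2 ^ c - 1)" and T: "T \<subseteq> {..<r}"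
  shows "coord (sub M *\<^sub>v k) T = coord k (\<Union>i\<in>T. row_support M i)"
proof (cases "T = {}")
  case True
  then show ?thesis by (simp add: coord_def)
next
  case False
  have dims: "dim_row M = r" "dim_col M = c" using binary_mats_carrier[OF M] by auto
  define U where "U = (\<Union>i\<in>T. row_support M i)"
  have U: "U \<subseteq> {..<c}" using row_support_subset[OF binary_mats_carrier[OF M]] by (auto simp: U_def)
  have finT: "finite T" using T finite_subset by blast
  have supp: "{j. j < c \<and> (\<Sum>i\<in>T. M $$ (i, j)) \<noteq> 0} = U"
  proof -
    \<comment> \<open>The entries are nonnegative, so nothing cancels in the column sum.\<close>
    have "(\<Sum>i\<in>T. M $$ (i, j)) = 0 \<longleftrightarrow> (\<forall>i\<in>T. M $$ (i, j) = 0)" if "j < c" for j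
    proof (rule sum_nonneg_eq_0_iff[OF finT])
      show "0 \<le> M $$ (i, j)" if "i \<in> T" for i
        using M T that \<open>j < c\<close> unfolding binary_mats_iff by fastforce
    qed
    then show ?thesis by (auto simp: U_def row_support_def dims)
  qed
  define t where "t = set_encode T - 1"
  have t: "t < 2 ^ r - 1" "set_decode (Suc t) = T"
    using set_encode_bound[OF T False] set_decode_Suc_encode[OF T False] by (auto simp: t_def)
  have "coord (sub M *\<^sub>v k) T = (sub M *\<^sub>v k) $ t" using False by (simp add: coord_def t_def)
  also have "\<dots> = (\<Sum>u<2 ^ c - 1. (if set_decode (Suc u) = U then k $ u else 0))"
    using k t supp by (auto simp: sub_def dims scalar_prod_def atLeast0LessThan intro!: sum.cong)
  also have "\<dots> = coord k U"
  \<comment> \<open>No column belongs to the empty set, so for empty \<open>U\<close> the row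
    vanishes, in agreement with the value 0 of \<open>coord\<close> at the empty set.\<close>
  proof (cases "U = {}")
    case True
    then show ?thesis by (simp add: coord_def set_decode_Suc_nonempty)
  next
    case False
    have "set_decode (Suc u) = U \<longleftrightarrow> u = set_encode U - 1" for u
      using set_decode_Suc_encode[OF U False] by (metis diff_Suc_1 set_decode_inverse)
    then have "(\<Sum>u<2 ^ c - 1. (if set_decode (Suc u) = U then k $ u else 0)) = k $ (set_encode U - 1)"
      using set_encode_bound[OF U False] by simp
    then show ?thesis using False by (simp add: coord_def)
  qed
  finally show ?thesis by (simp add: U_def)
qed

text \<open>Pullbacks compose, and the underlying set maps preserve unions, so they need to be
  compared on single variables only.\<close>

lemma sub_mult_sub_mult:
  assumes M: "M \<in> binary_mats a b" and N: "N \<in> binary_mats b c" and P: "P \<in> binary_mats a c"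
    and k: "k \<in> carrier_vec (2 ^ c - 1)"
    and supp: "\<And>i. i < a \<Longrightarrow> (\<Union>j\<in>row_support M i. row_support N j) = row_support P i"
  shows "sub M *\<^sub>v (sub N *\<^sub>v k) = sub P *\<^sub>v k"
proof (rule coord_ext)
  fix T assume T: "T \<subseteq> {..<a}"
  have "(\<Union>i\<in>T. row_support M i) \<subseteq> {..<b}"
    using row_support_subset[OF binary_mats_carrier[OF M]] by blast
  moreover have "(\<Union>j\<in>(\<Union>i\<in>T. row_support M i). row_support N j) = (\<Union>i\<in>T. row_support P i)"
    using T supp unfolding UN_UN_flatten by (intro SUP_cong) auto
  ultimately show "coord (sub M *\<^sub>v (sub N *\<^sub>v k)) T = coord (sub P *\<^sub>v k) T"
    using T by (simp add: coord_sub_mult[OF M sub_mult_carrier[OF N k]] coord_sub_mult[OF N k]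
        coord_sub_mult[OF P k])
qed (use assms sub_mult_carrier in auto)

lemma sub_one_mult: "sub (1\<^sub>m n) *\<^sub>v k = k" if "k \<in> carrier_vec (2 ^ n - 1)"
proof (rule coord_ext)
  fix T assume T: "T \<subseteq> {..<n}"
  then have "(\<Union>i\<in>T. row_support (1\<^sub>m n) i) = (\<Union>i\<in>T. {i})" by (intro SUP_cong) auto
  then have "(\<Union>i\<in>T. row_support (1\<^sub>m n) i) = T" by simp
  then show "coord (sub (1\<^sub>m n) *\<^sub>v k) T = coord k T"
    using coord_sub_mult[OF binary_mats_one that T] by simp
qed (use that sub_mult_carrier[OF binary_mats_one that] in auto)

text \<open>The identity block keeps each original variable, so adjoining auxiliaries leaves the old
  coordinates in place.\<close>

lemma vec_first_sub_mult:
  assumes S: "S \<in> binary_mats l n" and k: "k \<in> carrier_vec (2 ^ n - 1)"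
  shows "vec_first (sub (1\<^sub>m n @\<^sub>r S) *\<^sub>v k) (2 ^ n - 1) = k"
proof (rule coord_ext)
  fix T assume T: "T \<subseteq> {..<n}"
  have "(\<Union>i\<in>T. row_support (1\<^sub>m n @\<^sub>r S) i) = (\<Union>i\<in>T. {i})"
    using T by (intro SUP_cong)
      (auto simp: row_support_append_rows[OF one_carrier_mat binary_mats_carrier[OF S]])
  then have "(\<Union>i\<in>T. row_support (1\<^sub>m n @\<^sub>r S) i) = T" by simp
  moreover have "1\<^sub>m n @\<^sub>r S \<in> binary_mats (n + l) n" using S by auto
  moreover have "T \<subseteq> {..<n + l}" using T by auto
  ultimately show "coord (vec_first (sub (1\<^sub>m n @\<^sub>r S) *\<^sub>v k) (2 ^ n - 1)) T = coord k T"
    using T k by (simp add: coord_vec_first coord_sub_mult)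
qed (use k in auto)

section \<open>The Shannon cone\<close>

lemma shannon_cone_carrier: "k \<in> shannon_cone n \<Longrightarrow> k \<in> carrier_vec (2 ^ n - 1)"
  by (simp add: shannon_cone_def)

text \<open>The set map \<open>U\<close> preserves unions, but for intersections only
  \<open>U (S \<inter> T) \<subseteq> U S \<inter> U T\<close> holds. Monotonicity of
  \<open>k\<close> closes that gap in submodularity.\<close>

lemma sub_mult_shannon_cone:
  assumes M: "M \<in> binary_mats r c" and k: "k \<in> shannon_cone c"
  shows "sub M *\<^sub>v k \<in> shannon_cone r"
proof -
  note kc = shannon_cone_carrier[OF k]
  define U where "U T = (\<Union>i\<in>T. row_support M i)" for T
  have U: "U T \<subseteq> {..<c}" for T
    using row_support_subset[OF binary_mats_carrier[OF M]] by (auto simp: U_def)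
  have cd: "coord (sub M *\<^sub>v k) T = coord k (U T)" if "T \<subseteq> {..<r}" for T
    using coord_sub_mult[OF M kc that] by (simp add: U_def)
  have mono: "coord k S \<le> coord k T" if "S \<subseteq> T" "T \<subseteq> {..<c}" for S T
    using k that by (auto simp: shannon_cone_def)
  have subm: "coord k (S \<union> T) + coord k (S \<inter> T) \<le> coord k S + coord k T"
    if "S \<subseteq> {..<c}" "T \<subseteq> {..<c}" for S T
    using k that by (auto simp: shannon_cone_def)
  have "coord k (U (S \<union> T)) + coord k (U (S \<inter> T)) \<le> coord k (U S) + coord k (U T)" for S T
  proof -
    have "coord k (U (S \<inter> T)) \<le> coord k (U S \<inter> U T)"
      using U by (intro mono) (auto simp: U_def)
    moreover have "U (S \<union> T) = U S \<union> U T" by (auto simp: U_def)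
    ultimately show ?thesis using subm[OF U[of S] U[of T]] by simp
  qed
  moreover have "coord k (U S) \<le> coord k (U T)" if "S \<subseteq> T" for S T
    using that U by (intro mono) (auto simp: U_def)
  moreover have "sub M *\<^sub>v k \<in> carrier_vec (2 ^ r - 1)" using sub_mult_carrier[OF M kc] .
  ultimately show ?thesis
    unfolding shannon_cone_def by (auto simp: cd le_infI1 subset_trans)
qed

section \<open>The Shannon cone from instances of one conditional mutual information\<close>

abbreviation sha_row :: "real mat" where
  "sha_row \<equiv> mat_of_rows_list 7 [[0, 0, 0, -1, 1, 1, -1]]"

lemma sha_row_carrier: "sha_row \<in> carrier_mat 1 7"
  by (simp add: mat_of_rows_list_def One_nat_def)

text \<open>With X, Y, Z numbered 0, 1, 2, positions 3 to 6 hold H(Z), H(X,Z), H(Y,Z) and H(X,Y,Z),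
  so the row computes I(X;Y|Z).\<close>

lemma sha_row_nonneg_iff:
  assumes "v \<in> carrier_vec 7"
  shows "0\<^sub>v 1 \<le> sha_row *\<^sub>v v \<longleftrightarrow>
    coord v {2} + coord v {0, 1, 2} \<le> coord v {0, 2} + coord v {1, 2}"
proof -
  have idx: "set_encode {2} - 1 = 3" "set_encode {0, 2} - 1 = 4" "set_encode {1, 2} - 1 = 5"
    "set_encode {0, 1, 2} - 1 = 6" by (simp_all add: set_encode_def)
  have r: "{0..<7} = {0, 1, 2, 3, 4, 5, 6 :: nat}" by auto
  have "(sha_row *\<^sub>v v) $ 0 = - v $ 3 + v $ 4 + v $ 5 - v $ 6"
    using assms by (simp add: mat_of_rows_list_def scalar_prod_def r)
  moreover have "0\<^sub>v 1 \<le> sha_row *\<^sub>v v \<longleftrightarrow> 0 \<le> (sha_row *\<^sub>v v) $ 0"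
    using sha_row_carrier by (simp add: less_eq_vec_def)
  ultimately show ?thesis by (auto simp: coord_def idx)
qed

text \<open>Describes the cone by finitely many inequalities, each derivable from (Sha).\<close>

lemma shannon_cone_iff_sha_row:
  assumes k: "k \<in> carrier_vec (2 ^ n - 1)"
  shows "k \<in> shannon_cone n \<longleftrightarrow> (\<forall>S\<in>binary_mats 3 n. 0\<^sub>v 1 \<le> sha_row *\<^sub>v (sub S *\<^sub>v k))"
proof
  assume kc: "k \<in> shannon_cone n"
  show "\<forall>S\<in>binary_mats 3 n. 0\<^sub>v 1 \<le> sha_row *\<^sub>v (sub S *\<^sub>v k)"
  proof
    fix S assume S: "S \<in> binary_mats 3 n"
    have v: "sub S *\<^sub>v k \<in> shannon_cone 3" using sub_mult_shannon_cone[OF S kc] .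
    have "{0, 2} \<union> {1, 2} = {0, 1, 2 :: nat}" "{0, 2} \<inter> {1, 2} = {2 :: nat}"
      "{0, 2} \<subseteq> {..<3 :: nat}" "{1, 2} \<subseteq> {..<3 :: nat}" by auto
    with v have "coord (sub S *\<^sub>v k) {2} + coord (sub S *\<^sub>v k) {0, 1, 2}
        \<le> coord (sub S *\<^sub>v k) {0, 2} + coord (sub S *\<^sub>v k) {1, 2}"
      unfolding shannon_cone_def by (smt (verit) mem_Collect_eq)
    then show "0\<^sub>v 1 \<le> sha_row *\<^sub>v (sub S *\<^sub>v k)"
      using shannon_cone_carrier[OF v] by (subst sha_row_nonneg_iff) simp_all
  qed
next
  assume sha: "\<forall>S\<in>binary_mats 3 n. 0\<^sub>v 1 \<le> sha_row *\<^sub>v (sub S *\<^sub>v k)"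
  have gen: "coord k R + coord k (P \<union> Q \<union> R) \<le> coord k (P \<union> R) + coord k (Q \<union> R)"
    if PQR: "P \<subseteq> {..<n}" "Q \<subseteq> {..<n}" "R \<subseteq> {..<n}" for P Q R
  proof -
    \<comment> \<open>Replaces X, Y, Z by the joint variables over \<open>P\<close>,
      \<open>Q\<close>, \<open>R\<close>.\<close>
    define S where "S = indicator_mat 3 n (\<lambda>i. if i = 0 then P else if i = 1 then Q else R)"
    have S: "S \<in> binary_mats 3 n" by (auto simp: S_def)
    have "row_support S 0 = P" "row_support S 1 = Q" "row_support S 2 = R"
      using PQR by (simp_all add: S_def row_support_indicator_mat)
    moreover have "sub S *\<^sub>v k \<in> carrier_vec 7" using sub_mult_carrier[OF S k] by simp
    moreover have "0\<^sub>v 1 \<le> sha_row *\<^sub>v (sub S *\<^sub>v k)" using sha S by blast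
    ultimately show ?thesis
      by (simp add: sha_row_nonneg_iff coord_sub_mult[OF S k] Un_assoc)
  qed
  \<comment> \<open>Monotonicity is the case X = Y: the mutual information of \<open>T\<close> with
    itself given \<open>S\<close> is the conditional entropy of \<open>T\<close> given
    \<open>S\<close>.\<close>
  have "coord k S \<le> coord k T" if "S \<subseteq> T" "T \<subseteq> {..<n}" for S T
    using gen[of T T S] that by (simp add: Un_absorb2 subset_trans)
  moreover have "coord k (S \<union> T) + coord k (S \<inter> T) \<le> coord k S + coord k T"
    if "S \<subseteq> {..<n}" "T \<subseteq> {..<n}" for S T
  proof -
    \<comment> \<open>Submodularity is the mutual information of \<open>S\<close> and
      \<open>T\<close> conditioned on their intersection.\<close>
    have "S \<union> S \<inter> T = S" "T \<union> S \<inter> T = T" "S \<union> T \<union> S \<inter> T = S \<union> T" by auto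
    then show ?thesis using gen[of S T "S \<inter> T"] that by (simp add: le_infI1 add.commute)
  qed
  ultimately show "k \<in> shannon_cone n" using k by (auto simp: shannon_cone_def)
qed

section \<open>Soundness of the elementary rules\<close>

text \<open>Lets the substitution act on \<open>k\<close> first, so that the pullback lemmas
  apply.\<close>

lemma trivial_eii_iff:
  assumes A: "A \<in> carrier_mat mA (2 ^ n - 1)" and B: "B \<in> carrier_mat mB (2 ^ (n + l) - 1)"
  shows "trivial_eii n l A B \<longleftrightarrow> (\<exists>S\<in>binary_mats l n. \<forall>k\<in>shannon_cone n.
    0\<^sub>v mA \<le> A *\<^sub>v k \<longrightarrow> 0\<^sub>v mB \<le> B *\<^sub>v (sub (1\<^sub>m n @\<^sub>r S) *\<^sub>v k))"
proof -
  have "(B * sub (1\<^sub>m n @\<^sub>r S)) *\<^sub>v k = B *\<^sub>v (sub (1\<^sub>m n @\<^sub>r S) *\<^sub>v k)"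
    if "S \<in> binary_mats l n" "k \<in> shannon_cone n" for S k
  proof (rule assoc_mult_mat_vec[OF B])
    show "sub (1\<^sub>m n @\<^sub>r S) \<in> carrier_mat (2 ^ (n + l) - 1) (2 ^ n - 1)"
      using that by (intro sub_carrier binary_mats_carrier) auto
  qed (use that shannon_cone_carrier in auto)
  then show ?thesis using A B unfolding trivial_eii_def by auto
qed

lemma trivial_eii_Sha: "trivial_eii 3 0 (0\<^sub>m 0 7) sha_row"
proof -
  have S: "0\<^sub>m 0 3 \<in> binary_mats 0 3" by auto
  have one: "1\<^sub>m 3 @\<^sub>r 0\<^sub>m 0 3 = (1\<^sub>m 3 :: real mat)"
    by (rule append_rows_no_rows[OF one_carrier_mat]) simp
  have "0\<^sub>v 1 \<le> sha_row *\<^sub>v (sub (1\<^sub>m 3 @\<^sub>r 0\<^sub>m 0 3) *\<^sub>v k)" if "k \<in> shannon_cone 3" for k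
    using that shannon_cone_iff_sha_row[OF shannon_cone_carrier[OF that]] unfolding one by blast
  then show ?thesis
    using S trivial_eii_iff[of "0\<^sub>m 0 7" 0 3 sha_row 1 0] sha_row_carrier by auto
qed

text \<open>The new witness \<open>S1\<close> is \<open>S0\<close> with every original variable
  replaced according to \<open>S\<close>. Substituting and adjoining auxiliaries then commute: both
  orders give \<open>S @\<^sub>r S1\<close>.\<close>

lemma trivial_eii_SubV:
  assumes AB: "trivial_eii n l A B"
    and A: "A \<in> carrier_mat mA (2 ^ n - 1)" and B: "B \<in> carrier_mat mB (2 ^ (n + l) - 1)"
    and S: "S \<in> binary_mats n n'"
  shows "trivial_eii n' l (A * sub S) (B * sub (four_block_mat S (0\<^sub>m n l) (0\<^sub>m l n') (1\<^sub>m l)))"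
proof -
  let ?F = "four_block_mat S (0\<^sub>m n l) (0\<^sub>m l n') (1\<^sub>m l)"
  have F: "?F \<in> binary_mats (n + l) (n' + l)" using S by auto
  obtain S0 where S0: "S0 \<in> binary_mats l n"
    and imp: "\<And>k. k \<in> shannon_cone n \<Longrightarrow> 0\<^sub>v mA \<le> A *\<^sub>v k \<Longrightarrow>
      0\<^sub>v mB \<le> B *\<^sub>v (sub (1\<^sub>m n @\<^sub>r S0) *\<^sub>v k)"
    using AB unfolding trivial_eii_iff[OF A B] by blast
  define f where "f i = (\<Union>j\<in>row_support S0 i. row_support S j)" for i
  define S1 where "S1 = indicator_mat l n' f"
  have S1: "S1 \<in> binary_mats l n'" by (auto simp: S1_def)
  have f: "f i \<subseteq> {..<n'}" for i
    using row_support_subset[OF binary_mats_carrier[OF S]] by (auto simp: f_def)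
  note c = binary_mats_carrier[OF S] binary_mats_carrier[OF S0] binary_mats_carrier[OF S1]
  have rs: "row_support S1 i = f i" if "i < l" for i
    using that f by (simp add: S1_def row_support_indicator_mat)
  have E0: "1\<^sub>m n @\<^sub>r S0 \<in> binary_mats (n + l) n" and E1: "1\<^sub>m n' @\<^sub>r S1 \<in> binary_mats (n' + l) n'"
    using S0 S1 by auto
  have SS1: "S @\<^sub>r S1 \<in> binary_mats (n + l) n'" using S S1 by auto
  have comp1: "sub (1\<^sub>m n @\<^sub>r S0) *\<^sub>v (sub S *\<^sub>v k) = sub (S @\<^sub>r S1) *\<^sub>v k"
    if "k \<in> carrier_vec (2 ^ n' - 1)" for k
  proof (rule sub_mult_sub_mult[OF E0 S SS1 that])
    fix i assume "i < n + l"
    then show "(\<Union>j\<in>row_support (1\<^sub>m n @\<^sub>r S0) i. row_support S j) = row_support (S @\<^sub>r S1) i"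
      by (simp add: row_support_append_rows[OF one_carrier_mat c(2)]
          row_support_append_rows[OF c(1,3)] rs f_def)
  qed
  have comp2: "sub ?F *\<^sub>v (sub (1\<^sub>m n' @\<^sub>r S1) *\<^sub>v k) = sub (S @\<^sub>r S1) *\<^sub>v k"
    if "k \<in> carrier_vec (2 ^ n' - 1)" for k
  proof (rule sub_mult_sub_mult[OF F E1 SS1 that])
    fix i assume i: "i < n + l"
    show "(\<Union>j\<in>row_support ?F i. row_support (1\<^sub>m n' @\<^sub>r S1) j) = row_support (S @\<^sub>r S1) i"
    proof (cases "i < n")
      case True
      have "(\<Union>j\<in>row_support S i. row_support (1\<^sub>m n' @\<^sub>r S1) j) = (\<Union>j\<in>row_support S i. {j})"
        using row_support_subset[OF c(1), of i]
        by (intro SUP_cong) (auto simp: row_support_append_rows[OF one_carrier_mat c(3)])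
      then show ?thesis
        using True i by (simp add: row_support_block_diag[OF c(1)] row_support_append_rows[OF c(1,3)])
    next
      case False
      then show ?thesis
        using i by (simp add: row_support_block_diag[OF c(1)] row_support_append_rows[OF c(1,3)]
            row_support_append_rows[OF one_carrier_mat c(3)])
    qed
  qed
  have As: "A * sub S \<in> carrier_mat mA (2 ^ n' - 1)"
    and Bs: "B * sub ?F \<in> carrier_mat mB (2 ^ (n' + l) - 1)"
    using A B sub_carrier[OF c(1)] sub_carrier[OF binary_mats_carrier[OF F]] by auto
  have "0\<^sub>v mB \<le> (B * sub ?F) *\<^sub>v (sub (1\<^sub>m n' @\<^sub>r S1) *\<^sub>v k)"
    if k: "k \<in> shannon_cone n'" and Ak: "0\<^sub>v mA \<le> (A * sub S) *\<^sub>v k" for k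
  proof -
    note kc = shannon_cone_carrier[OF k]
    have "0\<^sub>v mA \<le> A *\<^sub>v (sub S *\<^sub>v k)"
      using Ak by (simp add: assoc_mult_mat_vec[OF A sub_carrier[OF c(1)] kc])
    from imp[OF sub_mult_shannon_cone[OF S k] this]
    have "0\<^sub>v mB \<le> B *\<^sub>v (sub ?F *\<^sub>v (sub (1\<^sub>m n' @\<^sub>r S1) *\<^sub>v k))"
      by (simp only: comp1[OF kc] comp2[OF kc])
    then show ?thesis
      by (simp only: assoc_mult_mat_vec[OF B sub_carrier[OF binary_mats_carrier[OF F]]
            sub_mult_carrier[OF E1 kc]])
  qed
  then show ?thesis unfolding trivial_eii_iff[OF As Bs] using S1 by blast
qed

text \<open>An auxiliary of the conclusion is a joint variable of original variables and premise
  auxiliaries. Resolving the latter by \<open>S0\<close> expresses it in original variables.\<close>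

lemma trivial_eii_SubA:
  assumes AB: "trivial_eii n l' A (B * sub ((1\<^sub>m n @\<^sub>c 0\<^sub>m n l') @\<^sub>r S))"
    and A: "A \<in> carrier_mat mA (2 ^ n - 1)" and B: "B \<in> carrier_mat mB (2 ^ (n + l) - 1)"
    and S: "S \<in> binary_mats l (n + l')"
  shows "trivial_eii n l A B"
proof -
  let ?F = "(1\<^sub>m n @\<^sub>c 0\<^sub>m n l') @\<^sub>r S"
  have F: "?F \<in> binary_mats (n + l) (n + l')" using S by auto
  have Bs: "B * sub ?F \<in> carrier_mat mB (2 ^ (n + l') - 1)"
    using B sub_carrier[OF binary_mats_carrier[OF F]] by auto
  obtain S0 where S0: "S0 \<in> binary_mats l' n"
    and imp: "\<And>k. k \<in> shannon_cone n \<Longrightarrow> 0\<^sub>v mA \<le> A *\<^sub>v k \<Longrightarrow>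
      0\<^sub>v mB \<le> (B * sub ?F) *\<^sub>v (sub (1\<^sub>m n @\<^sub>r S0) *\<^sub>v k)"
    using AB unfolding trivial_eii_iff[OF A Bs] by blast
  have E0: "1\<^sub>m n @\<^sub>r S0 \<in> binary_mats (n + l') n" using S0 by auto
  define f where "f i = (\<Union>j\<in>row_support S i. row_support (1\<^sub>m n @\<^sub>r S0) j)" for i
  define S1 where "S1 = indicator_mat l n f"
  have S1: "S1 \<in> binary_mats l n" by (auto simp: S1_def)
  have f: "f i \<subseteq> {..<n}" for i
    using row_support_subset[OF binary_mats_carrier[OF E0]] by (auto simp: f_def)
  have rs: "row_support S1 i = f i" if "i < l" for i
    using that f by (simp add: S1_def row_support_indicator_mat)
  note c = binary_mats_carrier[OF S] binary_mats_carrier[OF S0] binary_mats_carrier[OF S1]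
  have I0: "1\<^sub>m n @\<^sub>c 0\<^sub>m n l' \<in> binary_mats n (n + l')" by auto
  have E1: "1\<^sub>m n @\<^sub>r S1 \<in> binary_mats (n + l) n" using S1 by auto
  have comp: "sub ?F *\<^sub>v (sub (1\<^sub>m n @\<^sub>r S0) *\<^sub>v k) = sub (1\<^sub>m n @\<^sub>r S1) *\<^sub>v k"
    if "k \<in> carrier_vec (2 ^ n - 1)" for k
  proof (rule sub_mult_sub_mult[OF F E0 E1 that])
    fix i assume i: "i < n + l"
    show "(\<Union>j\<in>row_support ?F i. row_support (1\<^sub>m n @\<^sub>r S0) j) = row_support (1\<^sub>m n @\<^sub>r S1) i"
      using i by (auto simp: row_support_append_rows[OF binary_mats_carrier[OF I0] c(1)]
          row_support_append_cols_zero[OF one_carrier_mat] rs f_def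
          row_support_append_rows[OF one_carrier_mat c(2)]
          row_support_append_rows[OF one_carrier_mat c(3)])
  qed
  have "0\<^sub>v mB \<le> B *\<^sub>v (sub (1\<^sub>m n @\<^sub>r S1) *\<^sub>v k)"
    if k: "k \<in> shannon_cone n" and Ak: "0\<^sub>v mA \<le> A *\<^sub>v k" for k
  proof -
    note kc = shannon_cone_carrier[OF k]
    show ?thesis
      using imp[OF k Ak]
      by (simp only: comp[OF kc] assoc_mult_mat_vec[OF B sub_carrier[OF binary_mats_carrier[OF F]]
            sub_mult_carrier[OF E0 kc]])
  qed
  then show ?thesis unfolding trivial_eii_iff[OF A B] using S1 by blast
qed

lemma trivial_eii_Cone:
  assumes A: "A \<in> carrier_mat mA (2 ^ n - 1)" and D: "D \<in> carrier_mat r mA" "0\<^sub>m r mA \<le> D"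
  shows "trivial_eii n 0 A (D * A)"
proof -
  have DA: "D * A \<in> carrier_mat r (2 ^ (n + 0) - 1)" using A D by simp
  have S: "0\<^sub>m 0 n \<in> binary_mats 0 n" by auto
  have one: "1\<^sub>m n @\<^sub>r 0\<^sub>m 0 n = (1\<^sub>m n :: real mat)"
    by (rule append_rows_no_rows[OF one_carrier_mat]) simp
  have "0\<^sub>v r \<le> (D * A) *\<^sub>v (sub (1\<^sub>m n @\<^sub>r 0\<^sub>m 0 n) *\<^sub>v k)"
    if "k \<in> shannon_cone n" "0\<^sub>v mA \<le> A *\<^sub>v k" for k
    using nonneg_mat_mult_nonneg_vec[OF D that(2)] shannon_cone_carrier[OF that(1)]
    by (simp add: one sub_one_mult assoc_mult_mat_vec[OF D(1) A])
  then show ?thesis unfolding trivial_eii_iff[OF A DA] using S by blast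
qed

text \<open>The second batch of auxiliaries may use the first. Composing it with \<open>S0\<close>
  leaves only original variables, and the two batches are stacked.\<close>

lemma trivial_eii_Tran:
  assumes AB: "trivial_eii n l A B" and BC: "trivial_eii (n + l) k B C"
    and A: "A \<in> carrier_mat mA (2 ^ n - 1)" and B: "B \<in> carrier_mat mB (2 ^ (n + l) - 1)"
    and C: "C \<in> carrier_mat mC (2 ^ (n + l + k) - 1)"
  shows "trivial_eii n (l + k) A C"
proof -
  obtain S0 where S0: "S0 \<in> binary_mats l n"
    and imp0: "\<And>x. x \<in> shannon_cone n \<Longrightarrow> 0\<^sub>v mA \<le> A *\<^sub>v x \<Longrightarrow>
      0\<^sub>v mB \<le> B *\<^sub>v (sub (1\<^sub>m n @\<^sub>r S0) *\<^sub>v x)"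
    using AB unfolding trivial_eii_iff[OF A B] by blast
  obtain S1 where S1: "S1 \<in> binary_mats k (n + l)"
    and imp1: "\<And>x. x \<in> shannon_cone (n + l) \<Longrightarrow> 0\<^sub>v mB \<le> B *\<^sub>v x \<Longrightarrow>
      0\<^sub>v mC \<le> C *\<^sub>v (sub (1\<^sub>m (n + l) @\<^sub>r S1) *\<^sub>v x)"
    using BC unfolding trivial_eii_iff[OF B C] by blast
  have E0: "1\<^sub>m n @\<^sub>r S0 \<in> binary_mats (n + l) n"
    and E1: "1\<^sub>m (n + l) @\<^sub>r S1 \<in> binary_mats (n + l + k) (n + l)" using S0 S1 by auto
  define f where "f i = (\<Union>j\<in>row_support S1 i. row_support (1\<^sub>m n @\<^sub>r S0) j)" for i
  define S2 where "S2 = S0 @\<^sub>r indicator_mat k n f"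
  have S2: "S2 \<in> binary_mats (l + k) n" using S0 by (auto simp: S2_def)
  have E2: "1\<^sub>m n @\<^sub>r S2 \<in> binary_mats (n + l + k) n"
    using binary_mats_append_rows[OF binary_mats_one S2] by (simp add: add.assoc)
  have f: "f i \<subseteq> {..<n}" for i
    using row_support_subset[OF binary_mats_carrier[OF E0]] by (auto simp: f_def)
  note c = binary_mats_carrier[OF S0] binary_mats_carrier[OF S1] binary_mats_carrier[OF S2]
    binary_mats_carrier[OF indicator_mat_binary[of k n f]]
  have comp: "sub (1\<^sub>m (n + l) @\<^sub>r S1) *\<^sub>v (sub (1\<^sub>m n @\<^sub>r S0) *\<^sub>v x) = sub (1\<^sub>m n @\<^sub>r S2) *\<^sub>v x"
    if "x \<in> carrier_vec (2 ^ n - 1)" for x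
  proof (rule sub_mult_sub_mult[OF E1 E0 E2 that])
    fix i assume i: "i < n + l + k"
    \<comment> \<open>Row \<open>i - n\<close> of \<open>S2\<close> is an auxiliary of the first
      batch below \<open>l\<close>; the second batch starts at row \<open>n + l\<close> of the whole
      matrix.\<close>
    have S2i: "row_support S2 (i - n) =
        (if i - n < l then row_support S0 (i - n) else f (i - (n + l)))" if "n \<le> i"
      using i that f by (auto simp: S2_def row_support_append_rows[OF c(1,4)] row_support_indicator_mat)
    show "(\<Union>j\<in>row_support (1\<^sub>m (n + l) @\<^sub>r S1) i. row_support (1\<^sub>m n @\<^sub>r S0) j)
        = row_support (1\<^sub>m n @\<^sub>r S2) i"
      using i S2i by (cases "i < n + l") (auto simp: row_support_append_rows[OF one_carrier_mat c(2)]
          row_support_append_rows[OF one_carrier_mat c(1)]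
          row_support_append_rows[OF one_carrier_mat c(3)] f_def)
  qed
  have C': "C \<in> carrier_mat mC (2 ^ (n + (l + k)) - 1)" using C by (simp add: add.assoc)
  have "0\<^sub>v mC \<le> C *\<^sub>v (sub (1\<^sub>m n @\<^sub>r S2) *\<^sub>v x)"
    if x: "x \<in> shannon_cone n" and Ax: "0\<^sub>v mA \<le> A *\<^sub>v x" for x
    using imp1[OF sub_mult_shannon_cone[OF E0 x] imp0[OF x Ax]] comp[OF shannon_cone_carrier[OF x]]
    by simp
  then show ?thesis unfolding trivial_eii_iff[OF A C'] using S2 by blast
qed

text \<open>The same \<open>S\<close> works: padded \<open>A\<close> reads only the old coordinates,
  which the substitution preserves.\<close>

lemma trivial_eii_Abs:
  assumes AB: "trivial_eii n l A B"
    and A: "A \<in> carrier_mat mA (2 ^ n - 1)" and B: "B \<in> carrier_mat mB (2 ^ (n + l) - 1)"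
  shows "trivial_eii n l A (B @\<^sub>r (A @\<^sub>c 0\<^sub>m mA (2 ^ (n + l) - 2 ^ n)))"
proof -
  let ?q = "2 ^ (n + l) - 2 ^ n :: nat"
  have "(2::nat) ^ n \<le> 2 ^ (n + l)" by simp
  then have width: "2 ^ (n + l) - 1 = 2 ^ n - 1 + ?q" by (simp add: Suc_leI)
  have AP: "A @\<^sub>c 0\<^sub>m mA ?q \<in> carrier_mat mA (2 ^ (n + l) - 1)"
    unfolding width using A by (auto simp: append_cols_def)
  have BP: "B @\<^sub>r (A @\<^sub>c 0\<^sub>m mA ?q) \<in> carrier_mat (mB + mA) (2 ^ (n + l) - 1)"
    using carrier_append_rows[OF B AP] .
  obtain S where S: "S \<in> binary_mats l n"
    and imp: "\<And>k. k \<in> shannon_cone n \<Longrightarrow> 0\<^sub>v mA \<le> A *\<^sub>v k \<Longrightarrow>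
      0\<^sub>v mB \<le> B *\<^sub>v (sub (1\<^sub>m n @\<^sub>r S) *\<^sub>v k)"
    using AB unfolding trivial_eii_iff[OF A B] by blast
  have E: "1\<^sub>m n @\<^sub>r S \<in> binary_mats (n + l) n" using S by auto
  have "0\<^sub>v (mB + mA) \<le> (B @\<^sub>r (A @\<^sub>c 0\<^sub>m mA ?q)) *\<^sub>v (sub (1\<^sub>m n @\<^sub>r S) *\<^sub>v k)"
    if k: "k \<in> shannon_cone n" and Ak: "0\<^sub>v mA \<le> A *\<^sub>v k" for k
  proof -
    note kc = shannon_cone_carrier[OF k]
    note v = sub_mult_carrier[OF E kc]
    have "(A @\<^sub>c 0\<^sub>m mA ?q) *\<^sub>v (sub (1\<^sub>m n @\<^sub>r S) *\<^sub>v k) = A *\<^sub>v k"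
      using append_cols_zero_mult_vec[OF A v[unfolded width]] vec_first_sub_mult[OF S kc] by simp
    then show ?thesis using append_rows_nonneg_iff[OF B AP v] imp[OF k Ak] Ak by simp
  qed
  then show ?thesis unfolding trivial_eii_iff[OF A BP] using S by blast
qed

lemma deducible_imp_trivial: "deducible n l A B \<Longrightarrow> trivial_eii n l A B"
proof (induction rule: deducible.induct)
  case Sha
  show ?case by (rule trivial_eii_Sha)
next
  case SubV
  show ?case by (rule trivial_eii_SubV[OF SubV.IH SubV.hyps(2,3,5)])
next
  case SubA
  show ?case by (rule trivial_eii_SubA[OF SubA.IH SubA.hyps(2,3,4)])
next
  case Cone
  show ?case by (rule trivial_eii_Cone[OF Cone.hyps(1,2,3)])
next
  case Tran
  show ?case by (rule trivial_eii_Tran[OF Tran.IH Tran.hyps(3,4,5)])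
next
  case Abs
  show ?case by (rule trivial_eii_Abs[OF Abs.IH Abs.hyps(2,3)])
qed

section \<open>Completeness of the elementary rules\<close>

text \<open>(Cone) with a matrix without rows forgets \<open>A\<close>, (Tran) then reaches
  \<open>P\<close>, and (Abs) brings \<open>A\<close> back.\<close>

lemma deducible_append_rows:
  assumes A: "A \<in> carrier_mat mA (2 ^ n - 1)" and P: "P \<in> carrier_mat p (2 ^ n - 1)"
    and ded: "deducible n 0 (0\<^sub>m 0 (2 ^ n - 1)) P"
  shows "deducible n 0 A (P @\<^sub>r A)"
proof -
  have "deducible n 0 A (0\<^sub>m 0 mA * A)"
    using A by (rule deducible.Cone) auto
  moreover have "0\<^sub>m 0 mA * A = 0\<^sub>m 0 (2 ^ n - 1)" using A by auto
  ultimately have "deducible n 0 A P"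
    using deducible.Tran[of n 0 A "0\<^sub>m 0 (2 ^ n - 1)" 0 P mA 0 p] ded A P by simp
  from deducible.Abs[OF this A, of p] show ?thesis using A P by simp
qed

lemma deducible_sha_row:
  assumes S: "S \<in> binary_mats 3 n"
  shows "deducible n 0 (0\<^sub>m 0 (2 ^ n - 1)) (sha_row * sub S)"
proof (cases "n = 0")
  case True
  \<comment> \<open>(SubV) demands at least one variable, so \<open>n = 0\<close> is separate. The
    width is 0 there, and a row without entries comes from (Cone).\<close>
  have "sha_row * sub S = 0\<^sub>m 1 0 * 0\<^sub>m 0 (2 ^ n - 1)"
    using True sub_carrier[OF binary_mats_carrier[OF S]] sha_row_carrier by (intro eq_matI) auto
  moreover have "deducible n 0 (0\<^sub>m 0 (2 ^ n - 1)) (0\<^sub>m 1 0 * 0\<^sub>m 0 (2 ^ n - 1))"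
    by (rule deducible.Cone) auto
  ultimately show ?thesis by simp
next
  case False
  have "four_block_mat S (0\<^sub>m 3 0) (0\<^sub>m 0 n) (1\<^sub>m 0) = S"
    using binary_mats_carrier[OF S] by (intro eq_matI) auto
  moreover have "0\<^sub>m 0 7 * sub S = 0\<^sub>m 0 (2 ^ n - 1)"
    using sub_carrier[OF binary_mats_carrier[OF S]] by auto
  ultimately show ?thesis
    using deducible.SubV[OF deducible.Sha, of 0 1 n S] S False sha_row_carrier by simp
qed

text \<open>The stacking order is arbitrary, so \<open>M\<close> is specified by its solution set,
  which is all that Farkas' lemma needs.\<close>

lemma deducible_append_finite:
  assumes A: "A \<in> carrier_mat mA (2 ^ n - 1)" and fin: "finite \<S>"
    and "\<And>P. P \<in> \<S> \<Longrightarrow> P \<in> carrier_mat 1 (2 ^ n - 1) \<and> deducible n 0 (0\<^sub>m 0 (2 ^ n - 1)) P"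
  shows "\<exists>m. \<exists>M\<in>carrier_mat m (2 ^ n - 1). deducible n 0 A M \<and>
    (\<forall>k\<in>carrier_vec (2 ^ n - 1). 0\<^sub>v m \<le> M *\<^sub>v k \<longleftrightarrow>
      0\<^sub>v mA \<le> A *\<^sub>v k \<and> (\<forall>P\<in>\<S>. 0\<^sub>v 1 \<le> P *\<^sub>v k))"
  using fin assms(3)
proof (induction \<S>)
  case empty
  \<comment> \<open>(Cone) with the identity matrix gives reflexivity.\<close>
  have "deducible n 0 A (1\<^sub>m mA * A)"
    using A by (rule deducible.Cone) (auto simp: less_eq_mat_def)
  then show ?case using A by auto
next
  case (insert P \<S>)
  then obtain m M where M: "M \<in> carrier_mat m (2 ^ n - 1)" "deducible n 0 A M"
    "\<forall>k\<in>carrier_vec (2 ^ n - 1). 0\<^sub>v m \<le> M *\<^sub>v k \<longleftrightarrow>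
      0\<^sub>v mA \<le> A *\<^sub>v k \<and> (\<forall>P\<in>\<S>. 0\<^sub>v 1 \<le> P *\<^sub>v k)" by blast
  have P: "P \<in> carrier_mat 1 (2 ^ n - 1)" "deducible n 0 (0\<^sub>m 0 (2 ^ n - 1)) P"
    using insert.prems by auto
  have PM: "P @\<^sub>r M \<in> carrier_mat (1 + m) (2 ^ n - 1)" using carrier_append_rows[OF P(1) M(1)] .
  have "deducible n 0 A (P @\<^sub>r M)"
    using deducible.Tran[of n 0 A M 0 "P @\<^sub>r M" mA m "1 + m"] M(2)
      deducible_append_rows[OF M(1) P] A M(1) PM by simp
  moreover have "\<forall>k\<in>carrier_vec (2 ^ n - 1). 0\<^sub>v (1 + m) \<le> (P @\<^sub>r M) *\<^sub>v k \<longleftrightarrow>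
      0\<^sub>v mA \<le> A *\<^sub>v k \<and> (\<forall>P\<in>insert P \<S>. 0\<^sub>v 1 \<le> P *\<^sub>v k)"
    using M(3) append_rows_nonneg_iff[OF P(1) M(1)] by auto
  ultimately show ?case using PM by blast
qed

lemma trivial_imp_deducible:
  assumes A: "A \<in> carrier_mat mA (2 ^ n - 1)" and B: "B \<in> carrier_mat mB (2 ^ (n + l) - 1)"
    and triv: "trivial_eii n l A B"
  shows "deducible n l A B"
proof -
  let ?N = "2 ^ n - 1"
  have sub3: "sub S \<in> carrier_mat 7 ?N" if "S \<in> binary_mats 3 n" for S
    using sub_carrier[OF binary_mats_carrier[OF that]] by simp
  define \<S> where "\<S> = (\<lambda>S. sha_row * sub S) ` binary_mats 3 n"
  have "finite \<S>" unfolding \<S>_def using finite_binary_mats by blast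
  moreover have "P \<in> carrier_mat 1 ?N \<and> deducible n 0 (0\<^sub>m 0 ?N) P" if "P \<in> \<S>" for P
    using that mult_carrier_mat[OF sha_row_carrier sub3] deducible_sha_row by (auto simp: \<S>_def)
  ultimately obtain m M where M: "M \<in> carrier_mat m ?N" and AM: "deducible n 0 A M"
    and M_iff: "\<And>k. k \<in> carrier_vec ?N \<Longrightarrow> 0\<^sub>v m \<le> M *\<^sub>v k \<longleftrightarrow>
      0\<^sub>v mA \<le> A *\<^sub>v k \<and> (\<forall>P\<in>\<S>. 0\<^sub>v 1 \<le> P *\<^sub>v k)"
    using deducible_append_finite[OF A, of \<S>] by metis
  have cone: "k \<in> shannon_cone n \<longleftrightarrow> (\<forall>P\<in>\<S>. 0\<^sub>v 1 \<le> P *\<^sub>v k)" if "k \<in> carrier_vec ?N" for k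
    unfolding shannon_cone_iff_sha_row[OF that] \<S>_def
    using assoc_mult_mat_vec[OF sha_row_carrier sub3 that] by (simp del: assoc_mult_mat_vec)
  obtain S where S: "S \<in> binary_mats l n"
    and imp: "\<And>k. k \<in> shannon_cone n \<Longrightarrow> 0\<^sub>v mA \<le> A *\<^sub>v k \<Longrightarrow>
      0\<^sub>v mB \<le> (B * sub (1\<^sub>m n @\<^sub>r S)) *\<^sub>v k"
    using triv A B unfolding trivial_eii_def by auto
  have E: "1\<^sub>m n @\<^sub>r S \<in> binary_mats (n + l) n" using S by auto
  have BS: "B * sub (1\<^sub>m n @\<^sub>r S) \<in> carrier_mat mB ?N"
    using B sub_carrier[OF binary_mats_carrier[OF E]] by simp
  \<comment> \<open>The solutions of \<open>M\<close> are the points of the Shannon cone satisfying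
    \<open>A\<close>, so triviality is the hypothesis of Farkas' lemma.\<close>
  have "\<exists>D\<in>carrier_mat mB m. 0\<^sub>m mB m \<le> D \<and> B * sub (1\<^sub>m n @\<^sub>r S) = D * M"
    using M_iff cone imp by (intro farkas_mat[OF M BS]) simp
  then obtain D where D: "D \<in> carrier_mat mB m" "0\<^sub>m mB m \<le> D" "B * sub (1\<^sub>m n @\<^sub>r S) = D * M"
    by blast
  have "deducible n 0 A (B * sub (1\<^sub>m n @\<^sub>r S))"
    using deducible.Tran[of n 0 A M 0 "D * M" mA m mB] AM deducible.Cone[OF M D(1,2)] A M BS D(3)
    by simp
  moreover have "(1\<^sub>m n @\<^sub>c 0\<^sub>m n 0) = (1\<^sub>m n :: real mat)"
    by (rule append_cols_zero_width[OF one_carrier_mat])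
  \<comment> \<open>For \<open>l' = 0\<close> the matrix in (SubA) is just
    \<open>1\<^sub>m n @\<^sub>r S\<close>.\<close>
  ultimately show ?thesis
    using deducible.SubA[where n = n and l' = 0 and S = S, OF _ A B] S by simp
qed

section \<open>Equivalence of deducibility, triviality and nonnegative combination\<close>

theorem theorem11:
  fixes n l mA mB mG :: nat and A B G :: "real mat"
  assumes A: "A \<in> carrier_mat mA (2 ^ n - 1)"
    and B: "B \<in> carrier_mat mB (2 ^ (n + l) - 1)"
    and G: "G \<in> carrier_mat mG (2 ^ n - 1)" "describes_shannon_cone n G"
  shows "(deducible n l A B \<longleftrightarrow> trivial_eii n l A B) \<and>
    (trivial_eii n l A B \<longleftrightarrow>
      (\<exists>S \<in> binary_mats l n. \<exists>D \<in> carrier_mat mB (mA + mG).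
         0\<^sub>m mB (mA + mG) \<le> D \<and> B * sub (1\<^sub>m n @\<^sub>r S) = D * (A @\<^sub>r G)))"
proof (intro conjI)
  show "deducible n l A B \<longleftrightarrow> trivial_eii n l A B"
    using deducible_imp_trivial trivial_imp_deducible[OF A B] by blast
  let ?N = "2 ^ n - 1"
  have AG: "A @\<^sub>r G \<in> carrier_mat (mA + mG) ?N" using carrier_append_rows[OF A G(1)] .
  have AG_iff: "0\<^sub>v (mA + mG) \<le> (A @\<^sub>r G) *\<^sub>v k \<longleftrightarrow> 0\<^sub>v mA \<le> A *\<^sub>v k \<and> k \<in> shannon_cone n"
    if "k \<in> carrier_vec ?N" for k
    using append_rows_nonneg_iff[OF A G(1) that] G that unfolding describes_shannon_cone_def by auto
  \<comment> \<open>Triviality and the matrix identity are matched for each \<open>S\<close>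
    separately, so the same \<open>S\<close> witnesses both.\<close>
  have "(\<forall>k\<in>shannon_cone n. 0\<^sub>v mA \<le> A *\<^sub>v k \<longrightarrow> 0\<^sub>v mB \<le> (B * sub (1\<^sub>m n @\<^sub>r S)) *\<^sub>v k) \<longleftrightarrow>
      (\<exists>D \<in> carrier_mat mB (mA + mG).
         0\<^sub>m mB (mA + mG) \<le> D \<and> B * sub (1\<^sub>m n @\<^sub>r S) = D * (A @\<^sub>r G))" (is "?imp \<longleftrightarrow> ?comb")
    if S: "S \<in> binary_mats l n" for S
  proof
    have "1\<^sub>m n @\<^sub>r S \<in> binary_mats (n + l) n" using S by auto
    then have BS: "B * sub (1\<^sub>m n @\<^sub>r S) \<in> carrier_mat mB ?N"
      using B sub_carrier[OF binary_mats_carrier] by (meson mult_carrier_mat)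
    show ?comb if ?imp
      using AG_iff that by (intro farkas_mat[OF AG BS]) simp
    assume ?comb
    then obtain D where D: "D \<in> carrier_mat mB (mA + mG)" "0\<^sub>m mB (mA + mG) \<le> D"
      "B * sub (1\<^sub>m n @\<^sub>r S) = D * (A @\<^sub>r G)" by blast
    show ?imp
    proof (intro ballI impI)
      fix k assume k: "k \<in> shannon_cone n" "0\<^sub>v mA \<le> A *\<^sub>v k"
      note kc = shannon_cone_carrier[OF k(1)]
      show "0\<^sub>v mB \<le> (B * sub (1\<^sub>m n @\<^sub>r S)) *\<^sub>v k"
        using nonneg_mat_mult_nonneg_vec[OF D(1,2)] AG_iff[OF kc] k
        by (simp add: D(3) assoc_mult_mat_vec[OF D(1) AG kc])
    qed
  qed
  then show "trivial_eii n l A B \<longleftrightarrow>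
      (\<exists>S \<in> binary_mats l n. \<exists>D \<in> carrier_mat mB (mA + mG).
         0\<^sub>m mB (mA + mG) \<le> D \<and> B * sub (1\<^sub>m n @\<^sub>r S) = D * (A @\<^sub>r G))"
    unfolding trivial_eii_def carrier_matD(1)[OF A] carrier_matD(1)[OF B] by (rule bex_cong[OF refl])
qed

end
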